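(* Let $\frac{1}{15}\le\varepsilon<\frac{2}{3}$, and let $G$ be a 3-uniform hypergraph with vertex set $V$ and $m$ edges such that there is no partition of $V$ into three $\varepsilon$-good sets. Then there is a partition $V=A\cup B\cup C$ such that $A$ and $B$ are minimal $\varepsilon$-good sets and $$d(A)+d(B)+d(C)>(2+3\varepsilon)m.$$
   Context: A 3-uniform hypergraph has a finite vertex set $V$ and $m$ edges, each a distinct 3-element subset of $V$. For $A\subseteq V$, $d(A)$ denotes the number of edges meeting $A$ (i.e. having nonempty intersection with $A$). For $0<\varepsilon<\frac23$, a set $A\subseteq V$ is $\varepsilon$-good if $d(A)\ge\left(\frac{2}{3}-\varepsilon\right)m$, and $\varepsilon$-bad otherwise; it is minimal $\varepsilon$-good if it is $\varepsilon$-good and every proper subset of it is $\varepsilon$-bad. A partition of $V$ into three sets is an ordered triple of pairwise disjoint sets whose union is $V$. *)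

theory Defs
  imports Complex_Main
begin

definition three_uniform_hypergraph :: "'a set \<Rightarrow> 'a set set \<Rightarrow> bool" where
  "three_uniform_hypergraph V E \<longleftrightarrow> finite V \<and> (\<forall>e\<in>E. e \<subseteq> V \<and> card e = 3)"

definition edges_meeting :: "'a set set \<Rightarrow> 'a set \<Rightarrow> nat" where
  "edges_meeting E A = card {e \<in> E. e \<inter> A \<noteq> {}}"

definition eps_good :: "'a set \<Rightarrow> 'a set set \<Rightarrow> real \<Rightarrow> 'a set \<Rightarrow> bool" where
  "eps_good V E \<epsilon> A \<longleftrightarrow> A \<subseteq> V \<and> real (edges_meeting E A) \<ge> (2/3 - \<epsilon>) * real (card E)"

definition minimal_eps_good :: "'a set \<Rightarrow> 'a set set \<Rightarrow> real \<Rightarrow> 'a set \<Rightarrow> bool" where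
  "minimal_eps_good V E \<epsilon> A \<longleftrightarrow> eps_good V E \<epsilon> A \<and> (\<forall>B. B \<subset> A \<longrightarrow> \<not> eps_good V E \<epsilon> B)"

text \<open>Unlike in the library's \<open>partition_on\<close>, the parts are ordered and may be empty.\<close>

definition tripartition :: "'a set \<Rightarrow> 'a set \<Rightarrow> 'a set \<Rightarrow> 'a set \<Rightarrow> bool" where
  "tripartition V A B C \<longleftrightarrow>
     A \<union> B \<union> C = V \<and> A \<inter> B = {} \<and> A \<inter> C = {} \<and> B \<inter> C = {}"

end

theory Submission
  imports Defs
begin

text \<open>
  For a partition \<open>(A, B, C)\<close> and a vertex \<open>w\<close> of \<open>A\<close>, moving \<open>w\<close> to \<open>C\<close> costs \<open>A\<close> the
  \<open>l(w)\<close> edges that meet \<open>A\<close> in \<open>w\<close> alone and gains \<open>C\<close> the \<open>g(w)\<close> edges at \<open>w\<close> that miss \<open>C\<close>;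
  similarly for \<open>B\<close>. Counting edges by their type gives
  \<open>d(A) + d(B) + d(C) \<ge> 4m - 3d(C) + \<Sum>(l(w) - g(w))\<close>, the sum being over \<open>A \<union> B\<close>.
  So if \<open>C\<close> is bad and \<open>g \<le> l\<close> on \<open>A \<union> B\<close>, then the left-hand side exceeds \<open>(2 + 3\<epsilon>)m\<close>.

  In a partition maximising \<open>d(A) + d(B) + d(C)\<close> we have \<open>g \<le> l\<close>, and some part, say \<open>C\<close>, is bad.
  The other two are then good, since two bad parts would force
  \<open>d(A) + d(B) + d(C) < (7/3 - 2\<epsilon>)m \<le> (2 + 3\<epsilon>)m\<close>. Shrinking \<open>A\<close> and \<open>B\<close> to minimal good sets and
  giving the discarded vertices to \<open>C\<close> can only increase \<open>l\<close> and decrease \<open>g\<close>, and \<open>C\<close> stays bad.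
\<close>

text \<open>The loss \<open>l(w)\<close>: what \<open>A\<close> gives up when \<open>w\<close>
  leaves it.\<close>

definition sole_edges :: "'a set set \<Rightarrow> 'a set \<Rightarrow> 'a \<Rightarrow> nat" where
  "sole_edges E A w = card {e \<in> E. e \<inter> A = {w}}"

text \<open>The gain \<open>g(w)\<close>: what \<open>C\<close> receives when \<open>w\<close> joins
  it.\<close>

definition missing_edges :: "'a set set \<Rightarrow> 'a set \<Rightarrow> 'a \<Rightarrow> nat" where
  "missing_edges E C w = card {e \<in> E. w \<in> e \<and> e \<inter> C = {}}"

lemma finite_edges: "three_uniform_hypergraph V E \<Longrightarrow> finite E"
  unfolding three_uniform_hypergraph_def
  by (meson PowI finite_Pow_iff finite_subset subsetI)

lemma edges_meeting_le: "finite E \<Longrightarrow> edges_meeting E A \<le> card E"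
  unfolding edges_meeting_def by (rule card_mono) auto

lemma edges_meeting_remove:
  assumes "finite E" "w \<in> A"
  shows "edges_meeting E A = edges_meeting E (A - {w}) + sole_edges E A w"
proof -
  have "{e \<in> E. e \<inter> A \<noteq> {}} = {e \<in> E. e \<inter> (A - {w}) \<noteq> {}} \<union> {e \<in> E. e \<inter> A = {w}}"
    using assms(2) by auto
  then show ?thesis
    unfolding edges_meeting_def sole_edges_def
    using assms(1) by (subst card_Un_disjoint [symmetric]) auto
qed

lemma edges_meeting_insert:
  assumes "finite E"
  shows "edges_meeting E (insert w C) = edges_meeting E C + missing_edges E C w"
proof -
  have "{e \<in> E. e \<inter> insert w C \<noteq> {}} =
      {e \<in> E. e \<inter> C \<noteq> {}} \<union> {e \<in> E. w \<in> e \<and> e \<inter> C = {}}"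
    by auto
  then show ?thesis
    unfolding edges_meeting_def missing_edges_def
    using assms by (subst card_Un_disjoint [symmetric]) auto
qed

lemma sole_edges_antimono:
  assumes "finite E" "A' \<subseteq> A" "w \<in> A'"
  shows "sole_edges E A w \<le> sole_edges E A' w"
  unfolding sole_edges_def using assms by (intro card_mono) auto

lemma missing_edges_antimono:
  assumes "finite E" "C \<subseteq> C'"
  shows "missing_edges E C' w \<le> missing_edges E C w"
  unfolding missing_edges_def using assms by (intro card_mono) auto

lemma sum_card_swap:
  assumes "finite A" "finite E"
  shows "(\<Sum>w\<in>A. card {e \<in> E. R w e}) = (\<Sum>e\<in>E. card {w \<in> A. R w e})"
  using assms by (intro sum_multicount_gen) auto

lemma card_eq_sum_of_bool: "finite E \<Longrightarrow> card {e \<in> E. P e} = (\<Sum>e\<in>E. of_bool (P e))"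
  by (simp add: of_bool_def sum.If_cases Int_def)

lemma card_sole: "card {w \<in> A. e \<inter> A = {w}} = of_bool (card (e \<inter> A) = 1)"
proof (cases "card (e \<inter> A) = 1")
  case True
  then obtain x where "e \<inter> A = {x}" by (auto simp: card_1_singleton_iff)
  then have "{w \<in> A. e \<inter> A = {w}} = {x}" by auto
  then show ?thesis using True by simp
next
  case False
  then have "{w \<in> A. e \<inter> A = {w}} = {}" by auto
  then show ?thesis using False by (simp only: card.empty of_bool_eq)
qed

text \<open>The contribution of a single edge to the global count. Both sides depend only on the
  sizes \<open>a\<close>, \<open>b\<close>, \<open>c\<close> of the intersections of
  \<open>e\<close> with the parts. Equality holds except when \<open>c = 1\<close> and the other two
  vertices of \<open>e\<close> lie together in \<open>A\<close> or in \<open>B\<close>.\<close>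

lemma edge_count:
  assumes "tripartition V A B C" "e \<subseteq> V" "card e = 3"
  shows "4 + (card {w \<in> A. e \<inter> A = {w}} + card {w \<in> B. e \<inter> B = {w}})
    \<le> of_bool (e \<inter> A \<noteq> {}) + of_bool (e \<inter> B \<noteq> {}) + 4 * of_bool (e \<inter> C \<noteq> {})
      + (card {w \<in> A. w \<in> e \<and> e \<inter> C = {}} + card {w \<in> B. w \<in> e \<and> e \<inter> C = {}})"
proof -
  have fe: "finite e" using assms(3) by (metis card.infinite zero_neq_numeral)
  have "e = (e \<inter> A) \<union> (e \<inter> B) \<union> (e \<inter> C)"
    using assms(1,2) unfolding tripartition_def by auto
  moreover have "card ((e \<inter> A) \<union> (e \<inter> B) \<union> (e \<inter> C)) = card (e \<inter> A) + card (e \<inter> B) + card (e \<inter> C)"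
    using fe assms(1) unfolding tripartition_def
    by (subst card_Un_disjoint; auto)+
  ultimately have sum3: "card (e \<inter> A) + card (e \<inter> B) + card (e \<inter> C) = 3"
    using assms(3) by simp
  have empty: "e \<inter> X = {} \<longleftrightarrow> card (e \<inter> X) = 0" for X
    using fe by simp
  have miss: "card {w \<in> X. w \<in> e \<and> e \<inter> C = {}} = (if card (e \<inter> C) = 0 then card (e \<inter> X) else 0)" for X
  proof (cases "e \<inter> C = {}")
    case True
    then have "{w \<in> X. w \<in> e \<and> e \<inter> C = {}} = e \<inter> X" by auto
    then show ?thesis using True by simp
  qed (use fe in auto)
  have arith: "4 + (of_bool (a = 1) + of_bool (b = 1))
      \<le> of_bool (a \<noteq> 0) + of_bool (b \<noteq> 0) + 4 * of_bool (c \<noteq> 0)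
        + ((if c = 0 then a else 0) + (if c = 0 then b else 0))"
    if "a + b + c = 3" for a b c :: nat
  proof -
    from that have "a = 0 \<or> a = 1 \<or> a = 2 \<or> a = 3" by linarith
    moreover from that have "b = 0 \<or> b = 1 \<or> b = 2 \<or> b = 3" by linarith
    ultimately show ?thesis
      using that by (elim disjE; cases "c = 0"; simp)
  qed
  show ?thesis
    unfolding card_sole miss unfolding empty by (rule arith [OF sum3])
qed

lemma tripartition_count:
  assumes H: "three_uniform_hypergraph V E" and T: "tripartition V A B C"
    and A: "\<And>w. w \<in> A \<Longrightarrow> missing_edges E C w \<le> sole_edges E A w"
    and B: "\<And>w. w \<in> B \<Longrightarrow> missing_edges E C w \<le> sole_edges E B w"
  shows "4 * card E \<le> edges_meeting E A + edges_meeting E B + 4 * edges_meeting E C"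
proof -
  have fE: "finite E" using H by (rule finite_edges)
  have "finite V" using H by (simp add: three_uniform_hypergraph_def)
  then have fA: "finite A" and fB: "finite B"
    using T by (auto simp: tripartition_def)
  \<comment> \<open>Sum over all edges; exchanging the order of summation turns the incidence counts
    into vertex sums of losses and gains.\<close>
  have "(\<Sum>e\<in>E. 4 + (card {w \<in> A. e \<inter> A = {w}} + card {w \<in> B. e \<inter> B = {w}})) \<le>
    (\<Sum>e\<in>E. of_bool (e \<inter> A \<noteq> {}) + of_bool (e \<inter> B \<noteq> {}) + 4 * of_bool (e \<inter> C \<noteq> {})
      + (card {w \<in> A. w \<in> e \<and> e \<inter> C = {}} + card {w \<in> B. w \<in> e \<and> e \<inter> C = {}}))"
    using H by (intro sum_mono edge_count [OF T]) (auto simp: three_uniform_hypergraph_def)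
  then have "4 * card E + ((\<Sum>w\<in>A. sole_edges E A w) + (\<Sum>w\<in>B. sole_edges E B w)) \<le>
      edges_meeting E A + edges_meeting E B + 4 * edges_meeting E C
      + ((\<Sum>w\<in>A. missing_edges E C w) + (\<Sum>w\<in>B. missing_edges E C w))"
    unfolding sole_edges_def missing_edges_def edges_meeting_def
      sum_card_swap [OF fA fE] sum_card_swap [OF fB fE]
    unfolding card_eq_sum_of_bool [OF fE]
    by (simp only: sum.distrib sum_distrib_left [symmetric] sum_constant mult.commute of_nat_id)
  moreover have "(\<Sum>w\<in>A. missing_edges E C w) \<le> (\<Sum>w\<in>A. sole_edges E A w)"
    by (rule sum_mono) (rule A)
  moreover have "(\<Sum>w\<in>B. missing_edges E C w) \<le> (\<Sum>w\<in>B. sole_edges E B w)"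
    by (rule sum_mono) (rule B)
  ultimately show ?thesis by linarith
qed

text \<open>A good subset of \<open>A\<close> of least cardinality works, since a proper subset of a
  finite set is strictly smaller.\<close>

lemma minimal_eps_good_subset:
  assumes "finite V" "eps_good V E \<epsilon> A"
  obtains A' where "A' \<subseteq> A" "minimal_eps_good V E \<epsilon> A'"
proof -
  obtain A' where A': "A' \<subseteq> A" "eps_good V E \<epsilon> A'"
    and least: "\<And>B. B \<subseteq> A \<Longrightarrow> eps_good V E \<epsilon> B \<Longrightarrow> card A' \<le> card B"
    using ex_has_least_nat [of "\<lambda>X. X \<subseteq> A \<and> eps_good V E \<epsilon> X" A card] assms(2) by auto
  have "finite A'"
    using A'(2) assms(1) by (auto simp: eps_good_def intro: finite_subset)
  then have "\<not> eps_good V E \<epsilon> B" if "B \<subset> A'" for B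
    using that least [of B] A'(1) psubset_card_mono [of A' B] by auto
  then show thesis
    using that A' by (auto simp: minimal_eps_good_def)
qed

text \<open>The degree sum is bounded by \<open>3 * card E\<close>, so a maximum exists. It is
  symmetric in the three parts, so a part satisfying \<open>P\<close> can be moved to third place.
  \<open>P\<close> will be badness.\<close>

lemma max_tripartition_with:
  assumes "three_uniform_hypergraph V E"
    and ex: "\<And>A B C. tripartition V A B C \<Longrightarrow> P A \<or> P B \<or> P C"
  obtains A B C where "tripartition V A B C" "P C"
    and "\<And>A' B' C'. tripartition V A' B' C' \<Longrightarrow>
      edges_meeting E A' + edges_meeting E B' + edges_meeting E C'
        \<le> edges_meeting E A + edges_meeting E B + edges_meeting E C"
proof -
  define f where "f = (\<lambda>(A, B, C). edges_meeting E A + edges_meeting E B + edges_meeting E C)"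
  define Q where "Q = (\<lambda>(A, B, C). tripartition V A B C)"
  have fE: "finite E" using assms(1) by (rule finite_edges)
  have bound: "f t < 3 * card E + 1" for t
  proof (cases t)
    case (fields A B C)
    then show ?thesis
      using edges_meeting_le [OF fE, of A] edges_meeting_le [OF fE, of B]
        edges_meeting_le [OF fE, of C] by (simp add: f_def)
  qed
  have "Q ({}, {}, V)"
    by (simp add: Q_def tripartition_def)
  then have "\<exists>t. Q t \<and> (\<forall>u. Q u \<longrightarrow> f u \<le> f t)"
    by (rule ex_has_greatest_nat) (use bound in blast)
  then obtain t where "Q t" and t: "\<And>u. Q u \<Longrightarrow> f u \<le> f t"
    by auto
  obtain A B C where ABC: "t = (A, B, C)" by (rule prod_cases3)
  then have T: "tripartition V A B C"
    using \<open>Q t\<close> by (simp add: Q_def)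
  have max: "edges_meeting E A' + edges_meeting E B' + edges_meeting E C'
      \<le> edges_meeting E A + edges_meeting E B + edges_meeting E C"
    if "tripartition V A' B' C'" for A' B' C'
    using ABC t [of "(A', B', C')"] that by (simp add: f_def Q_def)
  have perms: "tripartition V B C A" "tripartition V A C B"
    using T by (auto simp: tripartition_def)
  from ex [OF T] consider "P A" | "P B" | "P C" by blast
  then show thesis
  proof cases
    case 1
    show thesis
      by (rule that [OF perms(1) 1]) (use max in \<open>simp add: add_ac\<close>)
  next
    case 2
    show thesis
      by (rule that [OF perms(2) 2]) (use max in \<open>simp add: add_ac\<close>)
  next
    case 3
    show thesis
      using T 3 max by (rule that)
  qed
qed

theorem theorem1:
  fixes V :: "'a set" and E :: "'a set set" and \<epsilon> :: real
  assumes "1/15 \<le> \<epsilon>" and "\<epsilon> < 2/3"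
    and "three_uniform_hypergraph V E"
    and "\<not> (\<exists>A B C. tripartition V A B C \<and>
              eps_good V E \<epsilon> A \<and> eps_good V E \<epsilon> B \<and> eps_good V E \<epsilon> C)"
  shows "\<exists>A B C. tripartition V A B C \<and>
           minimal_eps_good V E \<epsilon> A \<and> minimal_eps_good V E \<epsilon> B \<and>
           real (edges_meeting E A + edges_meeting E B + edges_meeting E C)
             > (2 + 3 * \<epsilon>) * real (card E)"
proof -
  let ?d = "edges_meeting E" and ?m = "real (card E)"
  have fE: "finite E" using assms(3) by (rule finite_edges)
  have fV: "finite V" using assms(3) by (simp add: three_uniform_hypergraph_def)
  have bad_iff: "\<not> eps_good V E \<epsilon> X \<longleftrightarrow> real (?d X) < (2/3 - \<epsilon>) * ?m" if "X \<subseteq> V" for X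
    using that by (auto simp: eps_good_def)
  \<comment> \<open>Subtracting \<open>3 * d(C)\<close> from the count leaves more than
    \<open>4m - 3(2/3 - \<epsilon>)m = (2 + 3\<epsilon>)m\<close>.\<close>
  have large: "real (?d A + ?d B + ?d C) > (2 + 3 * \<epsilon>) * ?m"
    if "tripartition V A B C" "\<not> eps_good V E \<epsilon> C"
      "\<And>w. w \<in> A \<Longrightarrow> missing_edges E C w \<le> sole_edges E A w"
      "\<And>w. w \<in> B \<Longrightarrow> missing_edges E C w \<le> sole_edges E B w" for A B C
  proof -
    have "4 * card E \<le> ?d A + ?d B + 4 * ?d C"
      using tripartition_count [OF assms(3)] that by blast
    then have "4 * ?m \<le> real (?d A) + real (?d B) + 4 * real (?d C)"
      by linarith
    moreover have "real (?d C) < (2/3 - \<epsilon>) * ?m"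
      using that(1,2) bad_iff by (auto simp: tripartition_def)
    ultimately show ?thesis by (simp add: algebra_simps)
  qed
  obtain A B C where T: "tripartition V A B C" and C: "\<not> eps_good V E \<epsilon> C"
    and max: "\<And>A' B' C'. tripartition V A' B' C' \<Longrightarrow> ?d A' + ?d B' + ?d C' \<le> ?d A + ?d B + ?d C"
    using max_tripartition_with [OF assms(3), of "\<lambda>X. \<not> eps_good V E \<epsilon> X"] assms(4) by blast
  \<comment> \<open>By maximality, moving \<open>w\<close> to \<open>C\<close> cannot raise the sum,
    so the gain is at most the loss.\<close>
  have lA: "missing_edges E C w \<le> sole_edges E A w" if "w \<in> A" for w
  proof -
    have "tripartition V (A - {w}) B (insert w C)"
      using T that by (auto simp: tripartition_def)
    from max [OF this] show ?thesis
      using edges_meeting_remove [OF fE that] edges_meeting_insert [OF fE, of w C] by linarith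
  qed
  have lB: "missing_edges E C w \<le> sole_edges E B w" if "w \<in> B" for w
  proof -
    have "tripartition V A (B - {w}) (insert w C)"
      using T that by (auto simp: tripartition_def)
    from max [OF this] show ?thesis
      using edges_meeting_remove [OF fE that] edges_meeting_insert [OF fE, of w C] by linarith
  qed
  have sub: "A \<subseteq> V" "B \<subseteq> V" "C \<subseteq> V"
    using T by (auto simp: tripartition_def)
  have S: "real (?d A + ?d B + ?d C) > (2 + 3 * \<epsilon>) * ?m"
    using large [OF T C lA lB] .
  have C': "real (?d C) < (2/3 - \<epsilon>) * ?m"
    using C bad_iff sub by blast
  \<comment> \<open>The constant 1/15 comes from here:
    \<open>7/3 - 2\<epsilon> \<le> 2 + 3\<epsilon>\<close> amounts to
    \<open>5\<epsilon> \<ge> 1/3\<close>.\<close>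
  have "(1/15) * ?m \<le> \<epsilon> * ?m"
    using assms(1) by (intro mult_right_mono) auto
  moreover have "real (?d A) \<le> ?m" "real (?d B) \<le> ?m"
    using edges_meeting_le [OF fE] by auto
  ultimately have good: "eps_good V E \<epsilon> A" "eps_good V E \<epsilon> B"
    using S C' sub by (auto simp: eps_good_def algebra_simps)
  obtain A' where A': "A' \<subseteq> A" "minimal_eps_good V E \<epsilon> A'"
    using minimal_eps_good_subset [OF fV good(1)] .
  obtain B' where B': "B' \<subseteq> B" "minimal_eps_good V E \<epsilon> B'"
    using minimal_eps_good_subset [OF fV good(2)] .
  define C'' where "C'' = V - A' - B'"
  have T': "tripartition V A' B' C''"
    using T A'(1) B'(1) by (auto simp: tripartition_def C''_def)
  have CC: "C \<subseteq> C''"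
    using T A'(1) B'(1) by (auto simp: tripartition_def C''_def)
  \<comment> \<open>Badness does not pass from \<open>C\<close> to the larger \<open>C''\<close>; it
    follows because three good parts are excluded.\<close>
  have "\<not> eps_good V E \<epsilon> C''"
  proof -
    have "eps_good V E \<epsilon> A'" "eps_good V E \<epsilon> B'"
      using A'(2) B'(2) by (simp_all add: minimal_eps_good_def)
    then show ?thesis using T' assms(4) by blast
  qed
  moreover have "missing_edges E C'' w \<le> sole_edges E A' w" if "w \<in> A'" for w
    using missing_edges_antimono [OF fE CC, of w] lA [OF subsetD [OF A'(1) that]]
      sole_edges_antimono [OF fE A'(1) that] by linarith
  moreover have "missing_edges E C'' w \<le> sole_edges E B' w" if "w \<in> B'" for w
    using missing_edges_antimono [OF fE CC, of w] lB [OF subsetD [OF B'(1) that]]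
      sole_edges_antimono [OF fE B'(1) that] by linarith
  \<comment> \<open>The new partition need not be maximal: \<open>large\<close> asks only for a bad
    third part and the vertexwise inequalities, which survive the shrinking.\<close>
  ultimately have "real (?d A' + ?d B' + ?d C'') > (2 + 3 * \<epsilon>) * ?m"
    using large [OF T'] by blast
  then show ?thesis
    using T' A'(2) B'(2) by blast
qed

end
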